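(* For every $\epsilon \in (0, 1/\sqrt{e})$ there exists $n(\epsilon)$ such that for all $n > n(\epsilon)$ the following holds: if $\mathcal{F} \subseteq \mathcal{M}_{2n}$ is an intersecting family with $|\mathcal{F}| > (1 - 1/\sqrt{e} + \epsilon)(2n-3)!!$, then there is an edge $ij$ of $K_{2n}$ such that $\mathcal{F} \subseteq \mathcal{F}_{ij} := \{ m \in \mathcal{M}_{2n} : ij \in m\}$.
   Context: $\mathcal{M}_{2n}$ denotes the set of perfect matchings of the complete graph $K_{2n}$ (each viewed as a set of $n$ edges). A family $\mathcal{F} \subseteq \mathcal{M}_{2n}$ is intersecting if $m \cap m' \neq \emptyset$ for all $m, m' \in \mathcal{F}$, i.e. any two members share an edge. $(2n-3)!! = 1 \cdot 3 \cdot 5 \cdots (2n-3)$. *)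

theory Defs
  imports Complex_Main "HOL-Library.Disjoint_Sets"
begin

definition complete_graph_edges :: "nat \<Rightarrow> nat set set" where
  "complete_graph_edges N = {e. e \<subseteq> {1..N} \<and> card e = 2}"

definition perfect_matchings :: "nat \<Rightarrow> nat set set set" where
  "perfect_matchings N = {m. m \<subseteq> complete_graph_edges N \<and> disjoint m \<and> \<Union>m = {1..N}}"

definition intersecting_family :: "'a set set \<Rightarrow> bool" where
  "intersecting_family F \<longleftrightarrow> (\<forall>m\<in>F. \<forall>m'\<in>F. m \<inter> m' \<noteq> {})"

definition matchings_containing :: "nat \<Rightarrow> nat set \<Rightarrow> nat set set set" where
  "matchings_containing N e = {m \<in> perfect_matchings N. e \<in> m}"

fun double_fact :: "nat \<Rightarrow> nat" where
  "double_fact 0 = 1"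
| "double_fact (Suc 0) = 1"
| "double_fact (Suc (Suc k)) = Suc (Suc k) * double_fact k"

lemma finite_perfect_matchings: "finite (perfect_matchings N)"
proof -
  have "perfect_matchings N \<subseteq> Pow (Pow {1..N})"
    by (auto simp: perfect_matchings_def complete_graph_edges_def)
  then show ?thesis
    by (rule finite_subset) simp
qed

lemma card_perfect_matching:
  assumes "m \<in> perfect_matchings (2 * n)"
  shows "card m = n"
proof -
  have m: "\<Union>m = {1..2 * n}" "disjoint m" "\<And>e. e \<in> m \<Longrightarrow> card e = 2"
    using assms by (auto simp: perfect_matchings_def complete_graph_edges_def)
  have "card (\<Union>m) = sum card m"
    using m by (intro card_Union_disjoint) (auto simp: disjoint_def pairwise_def disjnt_def intro: card_ge_0_finite)
  also have "\<dots> = 2 * card m"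
    using m(3) by simp
  finally show ?thesis
    using m(1) by simp
qed

end

theory Submission
  imports Defs "HOL-Analysis.Uniform_Limit" "HOL-Real_Asymp.Real_Asymp"
begin

text \<open>
  Let \<open>A\<close> and \<open>B\<close> be cross-intersecting. Growing a partial matching \<open>S\<close> by edges of members of \<open>A\<close>
  that miss \<open>S\<close>, the number of members of \<open>B\<close> containing \<open>S\<close> drops by a factor of at most \<open>n\<close> per
  step, whereas the number of all matchings containing \<open>S\<close> drops by nearly \<open>2 n\<close>. If \<open>B\<close> is not
  exponentially sparse, the process therefore stops after few steps, at a small \<open>S\<close> met by every
  member of \<open>A\<close>.

  With \<open>A = B = F\<close> this yields a small transversal \<open>T\<close> of \<open>F\<close>. Let \<open>e \<in> T\<close> be the edge of largest
  degree in \<open>F\<close>. For another \<open>f \<in> T\<close>, apply the process to the members containing \<open>e\<close> but not \<open>f\<close> and to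
  those containing \<open>f\<close> but not \<open>e\<close>: if the latter were numerous, the former would all contain one
  of few edges besides \<open>e\<close>, which is too restrictive. Hence all but \<open>o((2n-3)!!)\<close> members of \<open>F\<close>
  contain \<open>e\<close>. If some \<open>m \<in> F\<close> avoids \<open>e\<close>, the members containing \<open>e\<close> all meet \<open>m\<close>, and by
  inclusion-exclusion there are at most \<open>(1 - exp (- 1 / 2) + o(1)) (2n-3)!!\<close> of them.
\<close>

subsection \<open>Counting matchings\<close>

text \<open>This is (2k-1)!!, the number of perfect matchings on \<open>2 * k\<close> points.
  Truncated subtraction yields the correct value 1 at \<open>k = 0\<close>.\<close>

definition odd_fact :: "nat \<Rightarrow> nat" where
  "odd_fact k = double_fact (2 * k - 1)"

lemma odd_fact_0 [simp]: "odd_fact 0 = 1"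
  by (simp add: odd_fact_def)

lemma odd_fact_Suc [simp]: "odd_fact (Suc k) = (2 * k + 1) * odd_fact k"
  by (cases k) (simp_all add: odd_fact_def)

lemma odd_fact_pos [simp]: "odd_fact k > 0"
  by (induction k) auto

text \<open>The quotient of the two odd factorials is a product of \<open>k\<close> odd numbers, the
  least of which is \<open>2 * m + 1\<close>.\<close>

lemma odd_fact_growth:
  fixes x :: real
  assumes "0 \<le> x" and "x \<le> 2 * real m + 1"
  shows "x ^ k * real (odd_fact m) \<le> real (odd_fact (m + k))"
proof (induction k)
  case 0
  then show ?case by simp
next
  case (Suc k)
  have "x ^ Suc k * real (odd_fact m) = x * (x ^ k * real (odd_fact m))"
    by simp
  also have "\<dots> \<le> (2 * real (m + k) + 1) * real (odd_fact (m + k))"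
    using assms Suc by (intro mult_mono) auto
  finally show ?case
    by (simp add: algebra_simps)
qed

text \<open>Arbitrary vertex sets are allowed because fixing some edges leaves matchings of the
  uncovered vertices, which need not form an interval.\<close>

definition matchings_on :: "'a set \<Rightarrow> 'a set set set" where
  "matchings_on V = {m. (\<forall>e\<in>m. card e = 2) \<and> disjoint m \<and> \<Union>m = V}"

lemma perfect_matchings_eq: "perfect_matchings N = matchings_on {1..N}"
  by (auto simp: perfect_matchings_def matchings_on_def complete_graph_edges_def)

lemma matchings_on_disjoint:
  "m \<in> matchings_on V \<Longrightarrow> e \<in> m \<Longrightarrow> f \<in> m \<Longrightarrow> e \<noteq> f \<Longrightarrow> e \<inter> f = {}"
  by (simp add: matchings_on_def disjoint_def)

lemma finite_matchings_on: "finite V \<Longrightarrow> finite (matchings_on V)"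
  by (rule finite_subset[of _ "Pow (Pow V)"]) (auto simp: matchings_on_def)

lemma bij_betw_matchings_containing:
  assumes "disjoint S" and "\<And>e. e \<in> S \<Longrightarrow> card e = 2" and "\<Union>S \<subseteq> V"
  shows "bij_betw (\<lambda>m. m - S) {m \<in> matchings_on V. S \<subseteq> m} (matchings_on (V - \<Union>S))"
proof (rule bij_betw_byWitness[where f' = "\<lambda>m. m \<union> S"])
  have ne: "e \<noteq> {}" if "e \<in> S" for e
    using assms(2)[OF that] by auto
  show "\<forall>m\<in>{m \<in> matchings_on V. S \<subseteq> m}. m - S \<union> S = m"
    by auto
  show "\<forall>m\<in>matchings_on (V - \<Union>S). m \<union> S - S = m"
  proof
    fix m assume "m \<in> matchings_on (V - \<Union>S)"
    then have "\<Union>m = V - \<Union>S" by (simp add: matchings_on_def)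
    then have "e \<notin> S" if "e \<in> m" for e using that ne by blast
    then show "m \<union> S - S = m" by blast
  qed
  show "(\<lambda>m. m - S) ` {m \<in> matchings_on V. S \<subseteq> m} \<subseteq> matchings_on (V - \<Union>S)"
  proof (intro subsetI, elim imageE CollectE conjE)
    fix x m assume x: "x = m - S" and m: "m \<in> matchings_on V" "S \<subseteq> m"
    have dis: "e \<inter> f = {}" if "e \<in> m" "f \<in> S" "e \<notin> S" for e f
      using matchings_on_disjoint[OF m(1), of e f] m(2) that by blast
    have "\<Union>m = V"
      using m by (simp add: matchings_on_def)
    then have "\<Union>(m - S) = V - \<Union>S"
      using dis by blast
    moreover have "disjoint (m - S)"
      using m by (auto simp: matchings_on_def disjoint_def)
    ultimately show "x \<in> matchings_on (V - \<Union>S)"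
      using m x by (auto simp: matchings_on_def)
  qed
  show "(\<lambda>m. m \<union> S) ` matchings_on (V - \<Union>S) \<subseteq> {m \<in> matchings_on V. S \<subseteq> m}"
  proof (intro subsetI, elim imageE)
    fix x m assume x: "x = m \<union> S" and m: "m \<in> matchings_on (V - \<Union>S)"
    have "disjoint (m \<union> S)"
      using m assms(1) by (intro disjoint_union) (auto simp: matchings_on_def)
    then show "x \<in> {m \<in> matchings_on V. S \<subseteq> m}"
      using m x assms by (auto simp: matchings_on_def)
  qed
qed

text \<open>Classify the matchings by the partner \<open>w\<close> of a fixed vertex
  \<open>v\<close>: there are \<open>2 * k + 1\<close> choices, and each leaves a matching problem
  on \<open>2 * k\<close> vertices.\<close>

lemma card_matchings_on:
  assumes "finite V" and "card V = 2 * k"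
  shows "card (matchings_on V) = odd_fact k"
  using assms
proof (induction k arbitrary: V)
  case 0
  have "m = {}" if m: "m \<in> matchings_on {}" for m :: "'a set set"
  proof -
    have "m \<subseteq> {{}}" using m unfolding matchings_on_def by blast
    moreover have "{} \<notin> m" using m unfolding matchings_on_def by fastforce
    ultimately show ?thesis by blast
  qed
  moreover have "{} \<in> matchings_on ({} :: 'a set)"
    unfolding matchings_on_def disjoint_def by blast
  ultimately have "matchings_on {} = ({{}} :: 'a set set set)"
    by blast
  then show ?case using 0 by simp
next
  case (Suc k)
  then have "V \<noteq> {}" by auto
  then obtain v where v: "v \<in> V" by blast
  define G where "G w = {m \<in> matchings_on V. {{v, w}} \<subseteq> m}" for w
  have "matchings_on V = (\<Union>w\<in>V - {v}. G w)"
  proof (intro equalityI subsetI)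
    fix m assume m: "m \<in> matchings_on V"
    then obtain e where e: "e \<in> m" "v \<in> e" "card e = 2" using v by (auto simp: matchings_on_def)
    then obtain w where "e = {v, w}" "w \<noteq> v" by (auto simp: card_2_iff)
    then show "m \<in> (\<Union>w\<in>V - {v}. G w)"
      using m e by (auto simp: G_def matchings_on_def)
  qed (auto simp: G_def)
  also have "card \<dots> = (\<Sum>w\<in>V - {v}. card (G w))"
  proof (rule card_UN_disjoint)
    show "\<forall>w\<in>V - {v}. finite (G w)"
      using finite_matchings_on[OF Suc.prems(1)] by (simp add: G_def)
    show "\<forall>w\<in>V - {v}. \<forall>w'\<in>V - {v}. w \<noteq> w' \<longrightarrow> G w \<inter> G w' = {}"
    proof (intro ballI impI equals0I)
      fix w w' m assume ww: "w \<noteq> w'" "m \<in> G w \<inter> G w'"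
      then have "m \<in> matchings_on V" "{v, w} \<in> m" "{v, w'} \<in> m"
        by (auto simp: G_def)
      then have "{v, w} = {v, w'}"
        using matchings_on_disjoint by blast
      then show False using ww by (auto simp: doubleton_eq_iff)
    qed
  qed (use Suc in auto)
  also have "\<dots> = (\<Sum>w\<in>V - {v}. odd_fact k)"
  proof (rule sum.cong)
    fix w assume w: "w \<in> V - {v}"
    have "card (G w) = card (matchings_on (V - \<Union>{{v, w}}))"
      unfolding G_def using w v
      by (intro bij_betw_same_card[OF bij_betw_matchings_containing]) auto
    also have "\<dots> = odd_fact k"
      using Suc.prems w v by (intro Suc.IH) (auto simp: card_Diff_subset)
    finally show "card (G w) = odd_fact k" .
  qed simp
  also have "\<dots> = odd_fact (Suc k)"
    using Suc.prems v by simp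
  finally show ?case .
qed

lemma card_matching:
  assumes "finite V" and "card V = 2 * n" and "m \<in> matchings_on V"
  shows "finite m" and "card m = n"
proof -
  have m: "\<Union>m = V" "disjoint m" "\<And>e. e \<in> m \<Longrightarrow> card e = 2"
    using assms(3) by (auto simp: matchings_on_def)
  show "finite m"
    using m(1) assms(1) finite_UnionD by metis
  have "card (\<Union>m) = sum card m"
    using m by (intro card_Union_disjoint) (auto simp: disjoint_def pairwise_def disjnt_def intro: card_ge_0_finite)
  also have "\<dots> = 2 * card m"
    using m(3) by simp
  finally show "card m = n"
    using m(1) assms(2) by simp
qed

lemma card_matchings_extending:
  assumes "finite V" and "card V = 2 * n"
    and "disjoint S" and "\<And>e. e \<in> S \<Longrightarrow> card e = 2" and "\<Union>S \<subseteq> V"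
  shows "card {m \<in> matchings_on V. S \<subseteq> m} = odd_fact (n - card S)"
proof -
  have "card (\<Union>S) = sum card S"
    using assms(3,4) by (intro card_Union_disjoint) (auto simp: disjoint_def pairwise_def disjnt_def intro: card_ge_0_finite)
  also have "\<dots> = 2 * card S"
    using assms(4) by simp
  finally have "card (V - \<Union>S) = 2 * (n - card S)"
    using assms by (subst card_Diff_subset) (auto intro: finite_subset)
  then show ?thesis
    using bij_betw_same_card[OF bij_betw_matchings_containing[OF assms(3-5)]] assms(1)
    by (simp add: card_matchings_on)
qed

text \<open>If some matching extends \<open>S\<close>, then \<open>S\<close> inherits disjointness
  and edge size from it and the exact count applies; otherwise the count is 0.\<close>

lemma card_matchings_extending_le:
  assumes "finite V" and "card V = 2 * n"
  shows "card {m \<in> matchings_on V. S \<subseteq> m} \<le> odd_fact (n - card S)"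
proof (cases "{m \<in> matchings_on V. S \<subseteq> m} = {}")
  case False
  then obtain m where m: "m \<in> matchings_on V" "S \<subseteq> m" by blast
  then have "disjoint S"
    using matchings_on_disjoint[OF m(1)] by (meson disjointI subsetD)
  then have "card {m \<in> matchings_on V. S \<subseteq> m} = odd_fact (n - card S)"
    using assms m by (intro card_matchings_extending) (auto simp: matchings_on_def)
  then show ?thesis by simp
next
  case True
  then show ?thesis by (metis card.empty zero_le)
qed

text \<open>Inclusion-exclusion by induction on \<open>R\<close>: matchings that avoid
  \<open>R\<close> either avoid the new edge \<open>e\<close> as well or contain it. In the second
  case \<open>e\<close> moves into \<open>S\<close>, so \<open>S\<close> must stay general.\<close>

lemma card_matchings_avoiding:
  assumes V: "finite V" "card V = 2 * n" and "finite R"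
    and "disjoint (S \<union> R)" and "S \<inter> R = {}"
    and "\<And>e. e \<in> S \<union> R \<Longrightarrow> card e = 2" and "\<Union>(S \<union> R) \<subseteq> V"
  shows "int (card {m \<in> matchings_on V. S \<subseteq> m \<and> m \<inter> R = {}}) =
    (\<Sum>j\<le>card R. (-1) ^ j * int (card R choose j) * int (odd_fact (n - card S - j)))"
  using assms(3-)
proof (induction R arbitrary: S rule: finite_induct)
  case empty
  have "card {m \<in> matchings_on V. S \<subseteq> m} = odd_fact (n - card S)"
    using empty V by (intro card_matchings_extending) auto
  then show ?case by simp
next
  case (insert e R)
  let ?f = "\<lambda>S R. {m \<in> matchings_on V. S \<subseteq> m \<and> m \<inter> R = {}}"
  let ?g = "\<lambda>s r. \<Sum>j\<le>r. (-1) ^ j * int (r choose j) * int (odd_fact (n - s - j))"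
  have e: "e \<notin> S" "e \<notin> R" using insert by auto
  have "finite (\<Union>S)"
    by (rule finite_subset[OF _ V(1)]) (use insert in auto)
  then have fS: "finite S" by (rule finite_UnionD)
  have "card (?f S R) = card (?f S (insert e R) \<union> ?f (insert e S) R)"
    by (rule arg_cong[of _ _ card]) auto
  moreover have "card (?f S (insert e R) \<union> ?f (insert e S) R) =
      card (?f S (insert e R)) + card (?f (insert e S) R)"
    using finite_matchings_on[OF V(1)] by (intro card_Un_disjoint) auto
  moreover have "int (card (?f S R)) = ?g (card S) (card R)"
    using insert.prems by (intro insert.IH) (auto simp: disjoint_def)
  moreover have "int (card (?f (insert e S) R)) = ?g (card (insert e S)) (card R)"
    using insert.prems e by (intro insert.IH) auto
  moreover have "card (insert e S) = Suc (card S)"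
    using e fS by simp
  \<comment> \<open>Pascal's rule: shifting the index of the second sum by one flips its sign and
    aligns it with the first.\<close>
  moreover have "?g (card S) (card R) - ?g (Suc (card S)) (card R) = ?g (card S) (Suc (card R))"
  proof -
    let ?r = "card R" and ?s = "card S"
    let ?h = "\<lambda>j. int (odd_fact (n - ?s - j))"
    have "?g ?s (Suc ?r) = ?h 0 + (\<Sum>j\<le>?r. (-1) ^ Suc j * int (Suc ?r choose Suc j) * ?h (Suc j))"
      by (subst sum.atMost_Suc_shift) simp
    moreover have "(\<Sum>j\<le>?r. (-1) ^ Suc j * int (Suc ?r choose Suc j) * ?h (Suc j)) =
       (\<Sum>j\<le>?r. (-1) ^ Suc j * int (?r choose Suc j) * ?h (Suc j)) +
       (\<Sum>j\<le>?r. (-1) ^ Suc j * int (?r choose j) * ?h (Suc j))"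
      by (simp add: algebra_simps flip: sum.distrib)
    moreover have "(\<Sum>j\<le>Suc ?r. (-1) ^ j * int (?r choose j) * ?h j) =
       ?h 0 + (\<Sum>j\<le>?r. (-1) ^ Suc j * int (?r choose Suc j) * ?h (Suc j))"
      by (subst sum.atMost_Suc_shift) simp
    moreover have "(\<Sum>j\<le>Suc ?r. (-1) ^ j * int (?r choose j) * ?h j) = ?g ?s ?r" by simp
    moreover have "(\<Sum>j\<le>?r. (-1) ^ Suc j * int (?r choose j) * ?h (Suc j)) = - ?g (Suc ?s) ?r"
      by (simp add: sum_negf)
    ultimately show ?thesis by (simp del: sum.atMost_Suc binomial_Suc_Suc)
  qed
  ultimately have "int (card (?f S (insert e R))) = ?g (card S) (Suc (card R))"
    by (simp del: sum.atMost_Suc)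
  then show ?case by (simp only: card_insert_disjoint[OF insert.hyps])
qed

subsection \<open>Transversals of cross-intersecting families\<close>

text \<open>A member \<open>a\<close> of \<open>A\<close> that misses \<open>S\<close> meets every member of \<open>B\<close> extending \<open>S\<close>, so one of its
  \<open>n\<close> edges can be added to \<open>S\<close> while retaining a fraction \<open>1 / n\<close> of these members.\<close>

lemma cross_intersecting_branching:
  assumes V: "finite V" "card V = 2 * n"
    and A: "A \<subseteq> matchings_on V" and B: "B \<subseteq> matchings_on V" "B \<noteq> {}"
    and cross: "\<And>a b. a \<in> A \<Longrightarrow> b \<in> B \<Longrightarrow> a \<inter> b \<noteq> {}"
    and S0: "\<And>b. b \<in> B \<Longrightarrow> S0 \<subseteq> b"
  shows "(\<exists>S. S0 \<subseteq> S \<and> card S \<le> card S0 + k \<and> (\<exists>b\<in>B. S \<subseteq> b) \<and> (\<forall>a\<in>A. a \<inter> S \<noteq> {})) \<or>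
    (\<exists>S. S0 \<subseteq> S \<and> card S = card S0 + k \<and> card B \<le> n ^ k * card {b \<in> B. S \<subseteq> b})"
proof (induction k)
  case 0
  have "{b \<in> B. S0 \<subseteq> b} = B"
    using S0 by blast
  then show ?case by auto
next
  case (Suc k)
  have fB: "finite B"
    using B finite_matchings_on[OF V(1)] finite_subset by blast
  have "B \<noteq> {}" by fact
  then have cB: "card B > 0"
    using fB by (simp add: card_gt_0_iff)
  show ?case
  proof (cases "\<exists>S. S0 \<subseteq> S \<and> card S \<le> card S0 + k \<and> (\<exists>b\<in>B. S \<subseteq> b) \<and> (\<forall>a\<in>A. a \<inter> S \<noteq> {})")
    case True
    then show ?thesis by (meson add_le_mono le_SucI le_refl order_trans add_Suc_right)
  next
    case False
    then obtain S where S: "S0 \<subseteq> S" "card S = card S0 + k" "card B \<le> n ^ k * card {b \<in> B. S \<subseteq> b}"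
      using Suc by blast
    then have "card {b \<in> B. S \<subseteq> b} \<noteq> 0"
      using cB by (metis mult_0_right not_less)
    then have "{b \<in> B. S \<subseteq> b} \<noteq> {}"
      by (metis card.empty)
    then obtain b0 where b0: "b0 \<in> B" "S \<subseteq> b0" by blast
    then have fS: "finite S"
      using card_matching(1)[OF V] B(1) finite_subset by blast
    \<comment> \<open>\<open>S\<close> lies in the member \<open>b0\<close> of \<open>B\<close>, so
      it can only fail the first alternative by missing some member of \<open>A\<close>.\<close>
    have "\<not> (\<forall>a\<in>A. a \<inter> S \<noteq> {})"
      using False b0 S(1,2) by (metis order_refl)
    then obtain a where a: "a \<in> A" "a \<inter> S = {}" by blast
    have "a \<in> matchings_on V" using a A by blast
    then have am: "finite a" "card a = n" by (rule card_matching[OF V])+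
    have "{b \<in> B. S \<subseteq> b} \<subseteq> (\<Union>f\<in>a. {b \<in> B. insert f S \<subseteq> b})"
    proof
      fix b assume b: "b \<in> {b \<in> B. S \<subseteq> b}"
      then obtain f where "f \<in> a" "f \<in> b" using cross[OF a(1), of b] by auto
      then show "b \<in> (\<Union>f\<in>a. {b \<in> B. insert f S \<subseteq> b})" using b by auto
    qed
    then have "card {b \<in> B. S \<subseteq> b} \<le> card (\<Union>f\<in>a. {b \<in> B. insert f S \<subseteq> b})"
      by (intro card_mono finite_UN_I am) (use fB in auto)
    also have "\<dots> \<le> (\<Sum>f\<in>a. card {b \<in> B. insert f S \<subseteq> b})"
      by (rule card_UN_le) (rule am)
    finally have le: "card {b \<in> B. S \<subseteq> b} \<le> (\<Sum>f\<in>a. card {b \<in> B. insert f S \<subseteq> b})" .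
    \<comment> \<open>Averaging over the \<open>n\<close> edges of \<open>a\<close>.\<close>
    have "\<exists>f\<in>a. card {b \<in> B. S \<subseteq> b} \<le> n * card {b \<in> B. insert f S \<subseteq> b}"
    proof (rule ccontr)
      assume "\<not> ?thesis"
      then have *: "n * card {b \<in> B. insert f S \<subseteq> b} < card {b \<in> B. S \<subseteq> b}" if "f \<in> a" for f
        using that by auto
      have "a \<noteq> {}" using cross[OF a(1) b0(1)] by blast
      then have "(\<Sum>f\<in>a. n * card {b \<in> B. insert f S \<subseteq> b}) < (\<Sum>f\<in>a. card {b \<in> B. S \<subseteq> b})"
        using * am by (intro sum_strict_mono) auto
      then have "n * (\<Sum>f\<in>a. card {b \<in> B. insert f S \<subseteq> b}) < n * card {b \<in> B. S \<subseteq> b}"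
        using am by (simp add: sum_distrib_left)
      then show False using le by simp
    qed
    then obtain f where f: "f \<in> a" "card {b \<in> B. S \<subseteq> b} \<le> n * card {b \<in> B. insert f S \<subseteq> b}"
      by blast
    have "card B \<le> n ^ k * (n * card {b \<in> B. insert f S \<subseteq> b})"
      using S(3) mult_le_mono2[OF f(2), of "n ^ k"] by linarith
    moreover have "card (insert f S) = card S0 + Suc k"
      using f(1) a(2) fS S(2) by (subst card_insert_disjoint) auto
    ultimately show ?thesis
      using S(1) by (intro disjI2 exI[of _ "insert f S"]) (auto simp: mult_ac)
  qed
qed

text \<open>If the branching ran for all \<open>k\<close> steps, \<open>B\<close> would have at most
  \<open>n ^ k * odd_fact (n - card S0 - k)\<close> members. This is below the assumed size, since
  each of the \<open>k\<close> odd factors that were lost is at least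
  \<open>3 / 2 * n\<close>.\<close>

corollary cross_intersecting_transversal:
  assumes V: "finite V" "card V = 2 * n"
    and A: "A \<subseteq> matchings_on V" and B: "B \<subseteq> matchings_on V"
    and cross: "\<And>a b. a \<in> A \<Longrightarrow> b \<in> B \<Longrightarrow> a \<inter> b \<noteq> {}"
    and S0: "\<And>b. b \<in> B \<Longrightarrow> S0 \<subseteq> b"
    and k: "4 * (card S0 + k) \<le> n + 2" and "card S0 + k \<le> n"
    and large: "(2 / 3) ^ k * real (odd_fact (n - card S0)) < real (card B)"
  shows "\<exists>S. S0 \<subseteq> S \<and> card S \<le> card S0 + k \<and> (\<exists>b\<in>B. S \<subseteq> b) \<and> (\<forall>a\<in>A. \<exists>f\<in>S. f \<in> a)"
proof -
  have "0 \<le> (2 / 3) ^ k * real (odd_fact (n - card S0))" by simp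
  with large have "card B > 0" by linarith
  then have "B \<noteq> {}" by auto
  have fm: "finite (matchings_on V)" by (rule finite_matchings_on) fact
  have False if S: "S0 \<subseteq> S" "card S = card S0 + k" "card B \<le> n ^ k * card {b \<in> B. S \<subseteq> b}" for S
  proof -
    let ?m = "n - card S0 - k"
    have "card {b \<in> B. S \<subseteq> b} \<le> card {b \<in> matchings_on V. S \<subseteq> b}"
      using B fm by (intro card_mono) auto
    also have "\<dots> \<le> odd_fact (n - card S)"
      by (rule card_matchings_extending_le[OF V])
    finally have "card {b \<in> B. S \<subseteq> b} \<le> odd_fact ?m"
      using S(2) by simp
    then have "card B \<le> n ^ k * odd_fact ?m"
      using S(3) by (meson mult_le_mono2 order_trans)
    then have "real (card B) \<le> real (n ^ k * odd_fact ?m)"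
      by (rule of_nat_mono)
    also have "\<dots> = (2 / 3) ^ k * ((3 / 2 * real n) ^ k * real (odd_fact ?m))"
      by (simp add: power_mult_distrib power_divide)
    \<comment> \<open>The bound \<open>4 * (card S0 + k) \<le> n + 2\<close> amounts to
      \<open>3 / 2 * n \<le> 2 * ?m + 1\<close>.\<close>
    also have "\<dots> \<le> (2 / 3) ^ k * real (odd_fact (?m + k))"
      using k assms(8) by (intro mult_left_mono odd_fact_growth) auto
    also have "?m + k = n - card S0"
      using assms(8) by simp
    finally show False using large by simp
  qed
  then have "\<exists>S. S0 \<subseteq> S \<and> card S \<le> card S0 + k \<and> (\<exists>b\<in>B. S \<subseteq> b) \<and> (\<forall>a\<in>A. a \<inter> S \<noteq> {})"
    using cross_intersecting_branching[OF V A B \<open>B \<noteq> {}\<close> cross S0, of k] by meson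
  moreover have "a \<inter> S \<noteq> {} \<longleftrightarrow> (\<exists>f\<in>S. f \<in> a)" for a S :: "'a set set"
    by auto
  ultimately show ?thesis
    by simp
qed

text \<open>\<open>K\<close> is the number of branching steps and hence bounds the transversal. The
  condition on \<open>(3 / 2) ^ K\<close> makes families of relative size about 1/n large enough for
  branching; the one on \<open>K * (K + 1)\<close> rules out a second edge of substantial
  degree.\<close>

lemma intersecting_family_near_star:
  fixes K :: nat and \<epsilon> :: real
  assumes V: "finite V" "card V = 2 * n"
    and F: "F \<subseteq> matchings_on V" and int: "intersecting_family F"
    and large: "real (card F) > \<epsilon> * real (odd_fact (n - 1))" and "\<epsilon> > 0"
    and K: "4 * (K + 1) \<le> n + 2" "real n ^ 2 \<le> (3 / 2) ^ K"
    and n: "n \<ge> 2" "2 < \<epsilon> * real n" "real K * (real K + 1) < \<epsilon> * (2 * real n - 3)"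
  obtains e where "e \<subseteq> V" "card e = 2"
    "real (card {m \<in> F. e \<notin> m}) \<le> real K / real n * real (odd_fact (n - 1))"
proof -
  define D where "D = odd_fact (n - 1)"
  define M where "M = odd_fact (n - 2)"
  define k where "k = n - 2"
  have k: "n = Suc (Suc k)"
    using n(1) by (simp add: k_def)
  have DM: "real D = (2 * real n - 3) * real M"
    by (simp add: D_def M_def k algebra_simps)
  have ND: "real (odd_fact n) = (2 * real n - 1) * real D"
    by (simp add: D_def k algebra_simps)
  have fm: "finite (matchings_on V)" by (rule finite_matchings_on) fact
  have fF: "finite F" using F fm finite_subset by blast
  have K': "(2 / 3) ^ K * real n ^ 2 \<le> 1"
  proof -
    have "(2 / 3) ^ K * real n ^ 2 \<le> (2 / 3) ^ K * (3 / 2 :: real) ^ K"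
      using K by (intro mult_left_mono) auto
    also have "\<dots> = 1" by (simp flip: power_mult_distrib)
    finally show ?thesis .
  qed
  have n0: "real n > 0" using n by simp
  then have Kn: "(2 / 3) ^ K \<le> 1 / real n ^ 2"
    using K' by (simp add: pos_le_divide_eq)
  have "(2 / 3) ^ K * real (odd_fact n) \<le> 1 / real n ^ 2 * ((2 * real n - 1) * real D)"
    unfolding ND using Kn n by (intro mult_right_mono) auto
  also have "\<dots> \<le> 2 / real n * real D"
    using n0 by (simp add: field_simps power2_eq_square)
  also have "\<dots> \<le> \<epsilon> * real D"
    using n(2) n0 by (intro mult_right_mono) (auto simp: field_simps)
  also have "\<dots> < real (card F)"
    using large by (simp add: D_def)
  finally have "(2 / 3) ^ K * real (odd_fact (n - card ({} :: 'a set set))) < real (card F)"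
    by simp
  \<comment> \<open>An intersecting family is cross-intersecting with itself. As \<open>T\<close>
    lies in a member of \<open>F\<close>, it is finite and consists of edges on
    \<open>V\<close>.\<close>
  then have "\<exists>T. {} \<subseteq> T \<and> card T \<le> card ({} :: 'a set set) + K \<and> (\<exists>b\<in>F. T \<subseteq> b) \<and> (\<forall>a\<in>F. \<exists>f\<in>T. f \<in> a)"
    using int K(1)
    by (intro cross_intersecting_transversal[OF V F F]) (auto simp: intersecting_family_def)
  then obtain T b where T: "card T \<le> K" "b \<in> F" "T \<subseteq> b" "\<And>a. a \<in> F \<Longrightarrow> \<exists>f\<in>T. f \<in> a"
    by auto
  have bm: "b \<in> matchings_on V" using T F by blast
  then have fT: "finite T"
    using card_matching(1)[OF V] T finite_subset by blast
  have T0: "T \<noteq> {}" using T(2) T(4)[of b] by auto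
  let ?c = "\<lambda>e. card {m \<in> F. e \<in> m}"
  obtain e where e: "e \<in> T" "\<And>f. f \<in> T \<Longrightarrow> ?c f \<le> ?c e"
  proof -
    have "Max (?c ` T) \<in> ?c ` T" using fT T0 by (intro Max_in) auto
    then obtain e where "e \<in> T" "Max (?c ` T) = ?c e" by auto
    moreover have "?c f \<le> Max (?c ` T)" if "f \<in> T" for f
      using fT that by (intro Max_ge) auto
    ultimately show thesis using that[of e] by simp
  qed
  \<comment> \<open>Since \<open>T\<close> meets every member of \<open>F\<close>, the maximal
    degree is at least \<open>card F / K\<close>.\<close>
  have "F \<subseteq> (\<Union>f\<in>T. {m \<in> F. f \<in> m})" using T(4) by auto
  then have "card F \<le> card (\<Union>f\<in>T. {m \<in> F. f \<in> m})"
    using fT fF by (intro card_mono) auto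
  also have "\<dots> \<le> (\<Sum>f\<in>T. ?c f)" by (rule card_UN_le) fact
  also have "\<dots> \<le> card T * ?c e" using sum_bounded_above[of T ?c "?c e"] e(2) by simp
  also have "\<dots> \<le> K * ?c e" using T(1) by simp
  finally have "real (card F) \<le> real (K * ?c e)"
    by (rule of_nat_mono)
  then have Fe: "real (card F) \<le> real K * real (?c e)"
    by simp
  have small: "real (card {m \<in> F. f \<in> m \<and> e \<notin> m}) \<le> real D / real n" if f: "f \<in> T" "f \<noteq> e" for f
  proof (rule ccontr)
    assume c: "\<not> ?thesis"
    let ?A = "{m \<in> F. e \<in> m \<and> f \<notin> m}" and ?B = "{m \<in> F. f \<in> m \<and> e \<notin> m}"
    have "(2 / 3) ^ K * real (odd_fact (n - card {f})) \<le> 1 / real n ^ 2 * real D"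
      using mult_right_mono[OF Kn, of "real D"] by (simp add: D_def)
    also have "\<dots> \<le> real D / real n"
      using n(1) mult_left_mono[of 1 "real n" "real D"]
      by (simp add: divide_simps power2_eq_square)
    also have "\<dots> < real (card ?B)" using c by simp
    finally have large': "(2 / 3) ^ K * real (odd_fact (n - card {f})) < real (card ?B)" .
    \<comment> \<open>Branching starts from \<open>{f}\<close>, which all members of
      \<open>?B\<close> contain.\<close>
    have "\<exists>S. {f} \<subseteq> S \<and> card S \<le> card {f} + K \<and> (\<exists>b\<in>?B. S \<subseteq> b) \<and> (\<forall>a\<in>?A. \<exists>g\<in>S. g \<in> a)"
    proof (rule cross_intersecting_transversal[OF V])
      show "?A \<subseteq> matchings_on V" "?B \<subseteq> matchings_on V" using F by auto
      show "a \<inter> b \<noteq> {}" if "a \<in> ?A" "b \<in> ?B" for a b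
        using int that by (simp add: intersecting_family_def)
      show "{f} \<subseteq> b" if "b \<in> ?B" for b
        using that by simp
      show "4 * (card {f} + K) \<le> n + 2" "card {f} + K \<le> n"
        using K(1) n(1) by simp_all
      show "(2 / 3) ^ K * real (odd_fact (n - card {f})) < real (card ?B)"
        by (fact large')
    qed
    then obtain S where SS:
      "{f} \<subseteq> S \<and> card S \<le> card {f} + K \<and> (\<exists>b\<in>?B. S \<subseteq> b) \<and> (\<forall>a\<in>?A. \<exists>g\<in>S. g \<in> a)" ..
    note S = SS[THEN conjunct1] SS[THEN conjunct2, THEN conjunct1]
    note S' = SS[THEN conjunct2, THEN conjunct2, THEN conjunct2]
    from SS[THEN conjunct2, THEN conjunct2, THEN conjunct1]
    obtain b' where b': "b' \<in> ?B" "S \<subseteq> b'" ..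
    have fS: "finite S"
    proof -
      have "b' \<in> matchings_on V" using b'(1) F by auto
      then have "finite b'" by (rule card_matching(1)[OF V])
      with b'(2) show ?thesis by (rule finite_subset)
    qed
    \<comment> \<open>Members containing both \<open>e\<close> and \<open>f\<close> are covered by
      \<open>g = f\<close>, the others because \<open>S\<close> meets all of
      \<open>?A\<close>.\<close>
    have "{m \<in> F. e \<in> m} \<subseteq> (\<Union>g\<in>S. {m \<in> matchings_on V. {e, g} \<subseteq> m})"
    proof
      fix m assume m: "m \<in> {m \<in> F. e \<in> m}"
      then have "\<exists>g\<in>S. g \<in> m" using S(1) S' by (cases "f \<in> m") auto
      then show "m \<in> (\<Union>g\<in>S. {m \<in> matchings_on V. {e, g} \<subseteq> m})" using m F by auto
    qed
    then have "?c e \<le> card (\<Union>g\<in>S. {m \<in> matchings_on V. {e, g} \<subseteq> m})"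
      using fS fm by (intro card_mono) auto
    also have "\<dots> \<le> (\<Sum>g\<in>S. card {m \<in> matchings_on V. {e, g} \<subseteq> m})" by (rule card_UN_le) fact
    also have "\<dots> \<le> (\<Sum>g\<in>S. M)"
    proof (rule sum_mono)
      fix g assume "g \<in> S"
      \<comment> \<open>\<open>S\<close> lies in \<open>b'\<close>, which avoids \<open>e\<close>.
        So two distinct edges are prescribed, which costs a factor \<open>2 * n - 3\<close> against
        \<open>D\<close>.\<close>
      then have "e \<noteq> g" using b' by auto
      then have "card {e, g} = 2" by simp
      then show "card {m \<in> matchings_on V. {e, g} \<subseteq> m} \<le> M"
        using card_matchings_extending_le[OF V, of "{e, g}"] by (simp add: M_def)
    qed
    also have "\<dots> \<le> (K + 1) * M"
      using mult_le_mono1[of "card S" "K + 1" M] S(2) by simp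
    finally have "real (?c e) \<le> real ((K + 1) * M)"
      by (rule of_nat_mono)
    then have "real (?c e) \<le> (real K + 1) * real M"
      by (simp add: algebra_simps)
    then have "real K * real (?c e) \<le> real K * ((real K + 1) * real M)"
      by (intro mult_left_mono) auto
    then have "real (card F) \<le> (real K * (real K + 1)) * real M"
      using Fe by (simp add: mult.assoc)
    also have "\<dots> \<le> \<epsilon> * (2 * real n - 3) * real M"
      using n(3) by (intro mult_right_mono) auto
    finally have "real (card F) \<le> \<epsilon> * real D" by (simp add: DM mult.assoc)
    then show False using large by (simp add: D_def)
  qed
  \<comment> \<open>A member without \<open>e\<close> contains another edge of \<open>T\<close>; a
    union bound over at most \<open>K\<close> such edges finishes.\<close>
  have "{m \<in> F. e \<notin> m} \<subseteq> (\<Union>f\<in>T - {e}. {m \<in> F. f \<in> m \<and> e \<notin> m})"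
  proof
    fix m assume m: "m \<in> {m \<in> F. e \<notin> m}"
    then obtain f where "f \<in> T" "f \<in> m" using T(4)[of m] by auto
    then show "m \<in> (\<Union>f\<in>T - {e}. {m \<in> F. f \<in> m \<and> e \<notin> m})" using m by auto
  qed
  then have "card {m \<in> F. e \<notin> m} \<le> card (\<Union>f\<in>T - {e}. {m \<in> F. f \<in> m \<and> e \<notin> m})"
    using fT fF by (intro card_mono) auto
  also have "\<dots> \<le> (\<Sum>f\<in>T - {e}. card {m \<in> F. f \<in> m \<and> e \<notin> m})"
    using fT by (intro card_UN_le) auto
  finally have "real (card {m \<in> F. e \<notin> m}) \<le> real (\<Sum>f\<in>T - {e}. card {m \<in> F. f \<in> m \<and> e \<notin> m})"
    by (rule of_nat_mono)
  also have "\<dots> = (\<Sum>f\<in>T - {e}. real (card {m \<in> F. f \<in> m \<and> e \<notin> m}))" by simp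
  also have "\<dots> \<le> (\<Sum>f\<in>T - {e}. real D / real n)"
    using small by (intro sum_mono) auto
  also have "\<dots> = real (card (T - {e})) * (real D / real n)" by simp
  also have "\<dots> \<le> real K * (real D / real n)"
    using T(1) fT by (intro mult_right_mono of_nat_mono) (auto simp: card_Diff_singleton_if)
  finally have "real (card {m \<in> F. e \<notin> m}) \<le> real K / real n * real (odd_fact (n - 1))"
    by (simp add: D_def)
  moreover have "e \<subseteq> V" "card e = 2"
    using e(1) T(3) bm by (auto simp: matchings_on_def)
  ultimately show thesis using that by blast
qed

subsection \<open>Matchings meeting a given matching\<close>

text \<open>The edge \<open>e\<close> touches exactly two of the \<open>r + 2\<close> edges of
  \<open>m0\<close>. Only the other \<open>r\<close> can occur together with \<open>e\<close>, so
  inclusion-exclusion over them counts the matchings through \<open>e\<close> that miss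
  \<open>m0\<close>.\<close>

lemma card_matchings_meeting:
  assumes V: "finite V" "card V = 2 * (r + 2)" and m0: "m0 \<in> matchings_on V"
    and e: "e \<subseteq> V" "card e = 2" "e \<notin> m0"
  shows "int (card {m \<in> matchings_on V. e \<in> m \<and> m \<inter> m0 \<noteq> {}}) =
    int (odd_fact (Suc r)) - (\<Sum>j\<le>r. (-1) ^ j * int (r choose j) * int (odd_fact (Suc r - j)))"
proof -
  define R where "R = {f \<in> m0. f \<inter> e = {}}"
  have m0': "\<Union>m0 = V" "\<And>f. f \<in> m0 \<Longrightarrow> card f = 2"
    using m0 by (auto simp: matchings_on_def)
  have fm0: "finite m0" by (rule card_matching(1)[OF V m0])
  have cm0: "card m0 = r + 2" by (rule card_matching(2)[OF V m0])
  obtain i j where ij: "e = {i, j}" "i \<noteq> j" using e(2) by (auto simp: card_2_iff)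
  obtain f where f: "f \<in> m0" "i \<in> f" using ij e m0'(1) by auto
  obtain g where g: "g \<in> m0" "j \<in> g" using ij e m0'(1) by auto
  \<comment> \<open>An edge of \<open>m0\<close> covering both ends of \<open>e\<close> would be
    \<open>e\<close> itself.\<close>
  have "f \<noteq> g"
  proof
    assume "f = g"
    then have "e \<subseteq> f" using f g ij by simp
    moreover have "finite f" "card f = 2" using m0'(2)[OF f(1)] by (auto intro: card_ge_0_finite)
    ultimately have "e = f" using e(2) by (intro card_subset_eq) auto
    then show False using f e by simp
  qed
  have only: "h = f" if "h \<in> m0" "i \<in> h" for h
    using matchings_on_disjoint[OF m0 that(1) f(1)] f(2) that(2) by auto
  have only': "h = g" if "h \<in> m0" "j \<in> h" for h
    using matchings_on_disjoint[OF m0 that(1) g(1)] g(2) that(2) by auto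
  have R: "R = m0 - {f, g}"
  proof -
    have "h \<inter> e = {} \<longleftrightarrow> h \<notin> {f, g}" if "h \<in> m0" for h
      using only[OF that] only'[OF that] f(2) g(2) by (auto simp: ij(1))
    then show ?thesis unfolding R_def by blast
  qed
  have cR: "card R = r"
    unfolding R using f g \<open>f \<noteq> g\<close> cm0 fm0 by (simp add: card_Diff_subset)
  have eR: "{e} \<inter> R = {}" using e(3) by (auto simp: R_def)
  have dR: "disjoint ({e} \<union> R)"
    using matchings_on_disjoint[OF m0] by (auto simp: R_def disjoint_def)
  have "int (card {m \<in> matchings_on V. {e} \<subseteq> m \<and> m \<inter> R = {}}) =
    (\<Sum>j\<le>card R. (-1) ^ j * int (card R choose j) * int (odd_fact (r + 2 - card {e} - j)))"
    using m0' e by (intro card_matchings_avoiding[OF V _ dR eR] finite_subset[OF _ fm0]) (auto simp: R_def)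
  then have avoid: "int (card {m \<in> matchings_on V. {e} \<subseteq> m \<and> m \<inter> R = {}}) =
    (\<Sum>j\<le>r. (-1) ^ j * int (r choose j) * int (odd_fact (Suc r - j)))"
    by (simp add: cR)
  have R_iff: "m \<inter> m0 = {} \<longleftrightarrow> m \<inter> R = {}" if m: "m \<in> matchings_on V" "e \<in> m" for m
  proof -
    have "h \<in> R" if "h \<in> m" "h \<in> m0" for h
      using matchings_on_disjoint[OF m(1) that(1) m(2)] that e(3) by (auto simp: R_def)
    moreover have "R \<subseteq> m0" by (auto simp: R_def)
    ultimately show ?thesis by blast
  qed
  have "card {m \<in> matchings_on V. {e} \<subseteq> m} = odd_fact (Suc r)"
    using card_matchings_extending[OF V, of "{e}"] e by (auto simp: disjoint_def)
  moreover have "{m \<in> matchings_on V. {e} \<subseteq> m} =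
      {m \<in> matchings_on V. e \<in> m \<and> m \<inter> m0 \<noteq> {}} \<union> {m \<in> matchings_on V. {e} \<subseteq> m \<and> m \<inter> R = {}}"
    using R_iff by auto
  moreover have "card ({m \<in> matchings_on V. e \<in> m \<and> m \<inter> m0 \<noteq> {}} \<union> {m \<in> matchings_on V. {e} \<subseteq> m \<and> m \<inter> R = {}}) =
      card {m \<in> matchings_on V. e \<in> m \<and> m \<inter> m0 \<noteq> {}} + card {m \<in> matchings_on V. {e} \<subseteq> m \<and> m \<inter> R = {}}"
    using R_iff finite_matchings_on[OF V(1)] by (intro card_Un_disjoint) auto
  ultimately have "int (odd_fact (Suc r)) = int (card {m \<in> matchings_on V. e \<in> m \<and> m \<inter> m0 \<noteq> {}}) +
      int (card {m \<in> matchings_on V. {e} \<subseteq> m \<and> m \<inter> R = {}})"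
    by (simp del: odd_fact_Suc flip: of_nat_add)
  then show ?thesis unfolding avoid by linarith
qed

section \<open>Limit of the inclusion-exclusion sum\<close>

text \<open>The \<open>j\<close>-th term of the inclusion-exclusion sum, relative to the matchings containing a fixed edge.\<close>

definition sub_density :: "nat \<Rightarrow> nat \<Rightarrow> real" where
  "sub_density r j = real (r choose j) * real (odd_fact (Suc r - j)) / real (odd_fact (Suc r))"

lemma sub_density_0 [simp]: "sub_density r 0 = 1"
  using odd_fact_pos[of "Suc r"] by (simp add: sub_density_def del: odd_fact_Suc)

lemma sub_density_eq_0: "r < j \<Longrightarrow> sub_density r j = 0"
  by (simp add: sub_density_def)

text \<open>The binomial coefficient contributes \<open>(r - j) / (j + 1)\<close> and the odd
  factorial \<open>1 / (2 * (r - j) + 1)\<close>. For \<open>j \<ge> r\<close> both sides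
  vanish.\<close>

lemma sub_density_Suc:
  "sub_density r (Suc j) =
    sub_density r j * ((real r - real j) / (real (Suc j) * (2 * (real r - real j) + 1)))"
proof (cases "j < r")
  case True
  then have "Suc j * (r choose Suc j) = (r - j) * (r choose j)"
    using binomial_absorb_comp[of r j] times_binomial_minus1_eq[of "Suc j" r] by simp
  then have "real (Suc j * (r choose Suc j)) = real ((r - j) * (r choose j))"
    by (rule arg_cong)
  then have c: "real (Suc j) * real (r choose Suc j) = (real r - real j) * real (r choose j)"
    unfolding of_nat_mult using True by simp
  then have c: "real (r choose Suc j) = (real r - real j) * real (r choose j) / real (Suc j)"
    by (metis nonzero_mult_div_cancel_left of_nat_0_eq_iff nat.distinct(1))
  have "Suc r - j = Suc (r - j)"
    using True by simp
  then have "real (odd_fact (Suc r - j)) = real (2 * (r - j) + 1) * real (odd_fact (r - j))"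
    by (simp only: odd_fact_Suc of_nat_mult)
  then have o: "real (odd_fact (Suc r - j)) = (2 * (real r - real j) + 1) * real (odd_fact (Suc r - Suc j))"
    using True by (simp add: algebra_simps)
  have "2 * (real r - real j) + 1 \<noteq> 0"
    using True by simp
  then show ?thesis
    unfolding sub_density_def c o by (simp add: mult_ac del: odd_fact_Suc)
next
  case False
  then show ?thesis
    by (cases "j = r") (simp_all add: sub_density_eq_0)
qed

text \<open>Each ratio of consecutive terms is at most \<open>1 / (2 * (j + 1))\<close>. The result
  is a summable majorant independent of \<open>r\<close>.\<close>

lemma sub_density_bounds: "0 \<le> sub_density r j \<and> sub_density r j \<le> (1 / 2) ^ j / fact j"
proof (induction j)
  case 0
  show ?case by simp
next
  case (Suc j)
  show ?case
  proof (cases "j < r")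
    case True
    let ?x = "real r - real j"
    have x: "?x > 0" using True by simp
    have "?x / (real (Suc j) * (2 * ?x + 1)) \<le> 1 / (2 * real (Suc j))"
    proof -
      have "?x / (2 * ?x + 1) \<le> 1 / 2"
        using x by (simp add: field_simps)
      then have "1 / real (Suc j) * (?x / (2 * ?x + 1)) \<le> 1 / real (Suc j) * (1 / 2)"
        by (intro mult_left_mono) auto
      then show ?thesis by (simp add: mult_ac)
    qed
    moreover have "0 \<le> ?x / (real (Suc j) * (2 * ?x + 1))"
      using x by (intro divide_nonneg_nonneg mult_nonneg_nonneg) auto
    ultimately have "sub_density r (Suc j) \<le> (1 / 2) ^ j / fact j * (1 / (2 * real (Suc j)))"
      unfolding sub_density_Suc using Suc by (intro mult_mono) auto
    moreover have "sub_density r (Suc j) \<ge> 0"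
      by (simp add: sub_density_def)
    ultimately show ?thesis by (simp add: mult_ac)
  next
    case False
    then show ?thesis by (simp add: sub_density_eq_0)
  qed
qed

lemma sub_density_tendsto: "(\<lambda>r. sub_density r j) \<longlonglongrightarrow> (1 / 2) ^ j / fact j"
proof (induction j)
  case 0
  show ?case by simp
next
  case (Suc j)
  have "(\<lambda>r. (real r - real j) / (2 * (real r - real j) + 1)) \<longlonglongrightarrow> 1 / 2"
    by real_asymp
  then have "(\<lambda>r. 1 / real (Suc j) * ((real r - real j) / (2 * (real r - real j) + 1)))
      \<longlonglongrightarrow> 1 / real (Suc j) * (1 / 2)"
    by (intro tendsto_mult tendsto_const)
  from tendsto_mult[OF Suc this]
  have "(\<lambda>r. sub_density r (Suc j)) \<longlonglongrightarrow> (1 / 2) ^ j / fact j * (1 / real (Suc j) * (1 / 2))"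
    by (simp only: sub_density_Suc times_divide_times_eq mult_1)
  then show ?case by (simp add: mult_ac)
qed

text \<open>Terms with \<open>j > r\<close> are zero, so the finite sums are full series. Dominated
  convergence for series (Tannery) permits the limit term by term, giving the exponential series at
  -1/2.\<close>

lemma alternating_sub_density_tendsto:
  "(\<lambda>r. \<Sum>j\<le>r. (-1) ^ j * sub_density r j) \<longlonglongrightarrow> exp (- 1 / 2)"
proof -
  have "summable (\<lambda>j. (1 / 2 :: real) ^ j / fact j)"
    using summable_exp[of "1 / 2 :: real"] by (simp add: field_simps)
  moreover have "\<forall>\<^sub>F (j, r) in at_top \<times>\<^sub>F sequentially.
      norm ((-1) ^ j * sub_density r j) \<le> (1 / 2) ^ j / fact j"
    using sub_density_bounds by (intro always_eventually) (auto simp: abs_mult)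
  ultimately have "(\<lambda>r. \<Sum>j. (-1) ^ j * sub_density r j) \<longlonglongrightarrow> (\<Sum>j. (-1) ^ j * ((1 / 2) ^ j / fact j))"
    by (intro tannerys_theorem[THEN conjunct2, THEN conjunct2] tendsto_mult sub_density_tendsto tendsto_const) auto
  moreover have "(\<Sum>j. (-1) ^ j * sub_density r j) = (\<Sum>j\<le>r. (-1) ^ j * sub_density r j)" for r
    by (rule suminf_finite) (auto simp: sub_density_eq_0)
  moreover have "(\<Sum>j. (-1) ^ j * ((1 / 2) ^ j / fact j)) = exp (- 1 / 2 :: real)"
  proof -
    have "(-1) ^ j * ((1 / 2) ^ j / fact j) = (- 1 / 2 :: real) ^ j /\<^sub>R fact j" for j
      by (simp add: field_simps flip: power_mult_distrib)
    then show ?thesis by (simp add: exp_def)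
  qed
  ultimately show ?thesis by simp
qed

lemma card_matchings_meeting_density:
  assumes V: "finite V" "card V = 2 * (r + 2)" and m0: "m0 \<in> matchings_on V"
    and e: "e \<subseteq> V" "card e = 2" "e \<notin> m0"
  shows "real (card {m \<in> matchings_on V. e \<in> m \<and> m \<inter> m0 \<noteq> {}}) =
    (1 - (\<Sum>j\<le>r. (-1) ^ j * sub_density r j)) * real (odd_fact (Suc r))"
proof -
  have D: "real (odd_fact (Suc r)) \<noteq> 0"
    using odd_fact_pos[of "Suc r"] by linarith
  have "real (card {m \<in> matchings_on V. e \<in> m \<and> m \<inter> m0 \<noteq> {}}) =
      real_of_int (int (card {m \<in> matchings_on V. e \<in> m \<and> m \<inter> m0 \<noteq> {}}))"
    by simp
  also have "\<dots> = real (odd_fact (Suc r)) -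
      (\<Sum>j\<le>r. (-1) ^ j * real (r choose j) * real (odd_fact (Suc r - j)))"
    unfolding card_matchings_meeting[OF assms] by (simp del: odd_fact_Suc)
  also have "(\<Sum>j\<le>r. (-1) ^ j * real (r choose j) * real (odd_fact (Suc r - j))) =
      (\<Sum>j\<le>r. (-1) ^ j * sub_density r j) * real (odd_fact (Suc r))"
    unfolding sum_distrib_right sub_density_def using D
    by (intro sum.cong) (simp_all del: odd_fact_Suc)
  finally show ?thesis by (simp add: algebra_simps del: odd_fact_Suc)
qed

text \<open>Take \<open>K\<close> near the cube root of \<open>n\<close>: then \<open>K ^ 2\<close>
  is of lower order than \<open>n\<close>, while \<open>(3 / 2) ^ K\<close> still outgrows
  \<open>n ^ 2\<close>.\<close>

lemma eventually_transversal_bound: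
  fixes \<epsilon> :: real
  assumes "\<epsilon> > 0"
  shows "\<forall>\<^sub>F n in sequentially. \<exists>K. 4 * (K + 1) \<le> n + 2 \<and> real n ^ 2 \<le> (3 / 2) ^ K \<and>
    real K * (real K + 1) < \<epsilon> * (2 * real n - 3) \<and> real K / real n \<le> \<epsilon> / 2"
proof -
  let ?x = "\<lambda>n. real n powr (1 / 3)"
  have "\<forall>\<^sub>F n in sequentially. 4 * (?x n + 1) \<le> real n + 2"
    by real_asymp
  \<comment> \<open>The exponent is lowered by 1 to absorb the rounding in \<open>K\<close>.\<close>
  moreover have "\<forall>\<^sub>F n in sequentially. real n ^ 2 \<le> (3 / 2) powr (?x n - 1)"
    by real_asymp
  moreover have "\<forall>\<^sub>F n in sequentially. ?x n * (?x n + 1) < \<epsilon> * (2 * real n - 3)"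
    using assms by real_asymp
  moreover have "\<forall>\<^sub>F n in sequentially. ?x n / real n \<le> \<epsilon> / 2"
    using assms by real_asymp
  ultimately show ?thesis
  proof eventually_elim
    case (elim n)
    define K where "K = nat \<lfloor>?x n\<rfloor>"
    have K: "real K \<le> ?x n" "?x n - 1 \<le> real K"
      by (simp_all add: K_def)
    have "(3 / 2 :: real) powr (?x n - 1) \<le> (3 / 2) powr real K"
      using K by (intro powr_mono) auto
    also have "\<dots> = (3 / 2) ^ K"
      by (rule powr_realpow) simp
    finally have "real n ^ 2 \<le> (3 / 2) ^ K"
      using elim(2) by linarith
    moreover have "real (4 * (K + 1)) \<le> real (n + 2)"
      using K elim(1) by simp
    then have "4 * (K + 1) \<le> n + 2"
      by (simp only: of_nat_le_iff)
    moreover have "real K * (real K + 1) \<le> ?x n * (?x n + 1)"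
      using K by (intro mult_mono) auto
    then have "real K * (real K + 1) < \<epsilon> * (2 * real n - 3)"
      using elim(3) by linarith
    moreover have "real K / real n \<le> ?x n / real n"
      using K by (intro divide_right_mono) auto
    then have "real K / real n \<le> \<epsilon> / 2"
      using elim(4) by linarith
    ultimately show ?case
      by blast
  qed
qed

lemma exp_minus_half: "exp (- 1 / 2 :: real) = 1 / sqrt (exp 1)"
proof -
  have "sqrt (exp 1) = exp (1 / 2 :: real)"
    by (rule real_sqrt_unique) (simp_all add: power2_eq_square flip: exp_add)
  then show ?thesis by (simp add: exp_minus field_simps)
qed

subsection \<open>The stability theorem\<close>

theorem theorem1p2:
  fixes \<epsilon> :: real
  assumes "0 < \<epsilon>" and "\<epsilon> < 1 / sqrt (exp 1)"
  shows "\<exists>n0::nat. \<forall>n>n0. \<forall>F \<subseteq> perfect_matchings (2 * n).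
           intersecting_family F \<longrightarrow>
           real (card F) > (1 - 1 / sqrt (exp 1) + \<epsilon>) * real (double_fact (2 * n - 3)) \<longrightarrow>
           (\<exists>e \<in> complete_graph_edges (2 * n). F \<subseteq> matchings_containing (2 * n) e)"
proof -
  let ?c = "1 - 1 / sqrt (exp 1) :: real"
  let ?s = "\<lambda>r. \<Sum>j\<le>r. (-1) ^ j * sub_density r j"
  have c0: "?c > 0"
    by simp
  have "(\<lambda>r. 1 - ?s r) \<longlonglongrightarrow> ?c"
    unfolding exp_minus_half[symmetric]
    by (intro tendsto_diff tendsto_const alternating_sub_density_tendsto)
  \<comment> \<open>Half of \<open>\<epsilon>\<close> pays for the convergence, the other half for
    the members that avoid \<open>e\<close>.\<close>
  then have "\<forall>\<^sub>F r in sequentially. 1 - ?s r < ?c + \<epsilon> / 2"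
    using assms(1) by (intro order_tendstoD(2)) auto
  then obtain r0 where r0: "\<And>r. r \<ge> r0 \<Longrightarrow> 1 - ?s r < ?c + \<epsilon> / 2"
    by (auto simp: eventually_sequentially)
  obtain n1 where n1: "\<And>n. n \<ge> n1 \<Longrightarrow> \<exists>K. 4 * (K + 1) \<le> n + 2 \<and> real n ^ 2 \<le> (3 / 2) ^ K \<and>
    real K * (real K + 1) < \<epsilon> * (2 * real n - 3) \<and> real K / real n \<le> \<epsilon> / 2"
    using eventually_transversal_bound[OF assms(1)] by (auto simp: eventually_sequentially)
  obtain n2 :: nat where n2: "2 / \<epsilon> < real n2"
    using reals_Archimedean2 by blast
  show ?thesis
  proof (intro exI[of _ "max (max (r0 + 2) n1) n2"] allI impI)
    fix n F
    assume n: "n > max (max (r0 + 2) n1) n2" and F: "F \<subseteq> perfect_matchings (2 * n)"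
      and int: "intersecting_family F"
      and large: "real (card F) > (?c + \<epsilon>) * real (double_fact (2 * n - 3))"
    let ?V = "{1..2 * n}" and ?D = "real (odd_fact (n - 1))"
    have F': "F \<subseteq> matchings_on ?V"
      using F by (simp add: perfect_matchings_eq)
    have fF: "finite F"
      using F' by (rule finite_subset) (simp add: finite_matchings_on)
    \<comment> \<open>The matchings through a fixed edge number \<open>odd_fact (n - 1)\<close>, the
      scale used throughout.\<close>
    have D: "double_fact (2 * n - 3) = odd_fact (n - 1)"
      by (simp add: odd_fact_def diff_mult_distrib2)
    have "2 / \<epsilon> < real n" using n n2 by simp
    then have n3: "2 < \<epsilon> * real n"
      using assms(1) by (simp add: field_simps)
    have "\<epsilon> * ?D \<le> (?c + \<epsilon>) * ?D"
      using c0 by (intro mult_right_mono) auto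
    then have large': "real (card F) > \<epsilon> * ?D"
      using large unfolding D by linarith
    obtain K where K: "4 * (K + 1) \<le> n + 2" "real n ^ 2 \<le> (3 / 2) ^ K"
      "real K * (real K + 1) < \<epsilon> * (2 * real n - 3)" "real K / real n \<le> \<epsilon> / 2"
      using n1[of n] n by auto
    obtain e where e: "e \<subseteq> ?V" "card e = 2"
      and few: "real (card {m \<in> F. e \<notin> m}) \<le> real K / real n * ?D"
      using intersecting_family_near_star[OF _ _ F' int large' assms(1) K(1,2) _ n3 K(3)] n by auto
    have "e \<in> m0" if m0: "m0 \<in> F" for m0
    proof (rule ccontr)
      assume em0: "e \<notin> m0"
      define r where "r = n - 2"
      have r: "r \<ge> r0" "2 * n = 2 * (r + 2)" "n - 1 = Suc r"
        using n by (auto simp: r_def)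
      \<comment> \<open>A single member \<open>m0\<close> without \<open>e\<close> forces every
        member through \<open>e\<close> to meet \<open>m0\<close>, which caps their number near
        \<open>?c * ?D\<close>.\<close>
      have "{m \<in> F. e \<in> m} \<subseteq> {m \<in> matchings_on ?V. e \<in> m \<and> m \<inter> m0 \<noteq> {}}"
        using F' int m0 by (auto simp: intersecting_family_def)
      then have "card {m \<in> F. e \<in> m} \<le> card {m \<in> matchings_on ?V. e \<in> m \<and> m \<inter> m0 \<noteq> {}}"
        by (intro card_mono) (simp_all add: finite_matchings_on)
      then have "real (card {m \<in> F. e \<in> m}) \<le> real (card {m \<in> matchings_on ?V. e \<in> m \<and> m \<inter> m0 \<noteq> {}})"
        by (rule of_nat_mono)
      also have "\<dots> = (1 - ?s r) * ?D"
        unfolding r(3) using r(2) m0 F' e em0 by (intro card_matchings_meeting_density) auto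
      also have "\<dots> \<le> (?c + \<epsilon> / 2) * ?D"
        using r0[OF r(1)] by (intro mult_right_mono) auto
      finally have meet: "real (card {m \<in> F. e \<in> m}) \<le> (?c + \<epsilon> / 2) * ?D" .
      have "real (card {m \<in> F. e \<notin> m}) \<le> \<epsilon> / 2 * ?D"
        using few K(4) by (meson mult_right_mono of_nat_0_le_iff order_trans)
      \<comment> \<open>Together the two halves of \<open>\<epsilon>\<close> give exactly the
        threshold that \<open>card F\<close> exceeds.\<close>
      then have "real (card {m \<in> F. e \<in> m}) + real (card {m \<in> F. e \<notin> m}) \<le> (?c + \<epsilon>) * ?D"
        using meet by (simp add: ring_distribs)
      moreover have "card F = card ({m \<in> F. e \<in> m} \<union> {m \<in> F. e \<notin> m})"
        by (rule arg_cong[of _ _ card]) auto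
      moreover have "card ({m \<in> F. e \<in> m} \<union> {m \<in> F. e \<notin> m}) = card {m \<in> F. e \<in> m} + card {m \<in> F. e \<notin> m}"
        using fF by (intro card_Un_disjoint) auto
      ultimately show False
        using large unfolding D by linarith
    qed
    then have "F \<subseteq> matchings_containing (2 * n) e"
      using F by (auto simp: matchings_containing_def)
    moreover have "e \<in> complete_graph_edges (2 * n)"
      using e by (simp add: complete_graph_edges_def)
    ultimately show "\<exists>e \<in> complete_graph_edges (2 * n). F \<subseteq> matchings_containing (2 * n) e"
      by blast
  qed
qed

end
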